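(* Let $N\geq 2$ and let $S$ be a closed nowhere dense subset of $\mathbb{R}^{N}$ with no bounded connected component such that $\mathbb{R}^{N}\setminus S$ is connected. Then there exists a family $(u_{\nu})$ of subharmonic functions on $\mathbb{R}^{N}$ such that $u:=\sup_{\nu}u_{\nu}$ is finite everywhere and is locally unbounded at each point of $S$.
   Context: A function $v:\omega\to[-\infty,+\infty)$ on an open set $\omega\subset\mathbb{R}^{N}$ is subharmonic if it is upper semicontinuous, $v\not\equiv-\infty$, and for every ball $B(x,\rho)$ relatively compact in $\omega$ the value $v(x)$ is at most the mean of $v$ over the sphere $\partial B(x,\rho)$ with respect to surface measure. A function is locally unbounded at a point if it is not bounded above on any neighborhood of that point. *)

theory Defs
  imports "HOL-Analysis.Analysis"
begin

(* Surface measure on the sphere of centre x and radius r > 0, in polar coordinates: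
   with N the dimension, a Borel set A of the sphere has measure N / r times the Lebesgue
   measure of the cone {x + t *R (y - x) | y : A, 0 < t < 1} over A
   (see emeasure_sphere_measure below). *)
definition sphere_measure :: "'a::euclidean_space \<Rightarrow> real \<Rightarrow> 'a measure" where
  "sphere_measure x r =
     scale_measure (ennreal (real DIM('a) / r))
       (distr (restrict_space lborel (ball x r - {x})) (restrict_space borel (sphere x r))
          (\<lambda>y. x + (r / dist x y) *\<^sub>R (y - x)))"

(* Mean of an extended-real-valued function over a sphere. The map e2ennreal sends negative
   values to 0, so the numerator is the integral of the positive part minus that of the
   negative part. If v is upper semicontinuous and < \<infinity> on the sphere, then the first of
   these is finite, so the difference is never of the form \<infinity> - \<infinity>. *)
definition sphere_mean :: "('a::euclidean_space \<Rightarrow> ereal) \<Rightarrow> 'a \<Rightarrow> real \<Rightarrow> ereal" where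
  "sphere_mean v x r =
     (enn2ereal (\<integral>\<^sup>+ y. e2ennreal (v y) \<partial>sphere_measure x r)
       - enn2ereal (\<integral>\<^sup>+ y. e2ennreal (- v y) \<partial>sphere_measure x r))
     / enn2ereal (emeasure (sphere_measure x r) (sphere x r))"

definition usc_on :: "'a::topological_space set \<Rightarrow> ('a \<Rightarrow> ereal) \<Rightarrow> bool" where
  "usc_on \<omega> v \<longleftrightarrow> (\<forall>x\<in>\<omega>. \<forall>c. v x < c \<longrightarrow> (\<forall>\<^sub>F y in at x within \<omega>. v y < c))"

definition subharmonic_on :: "'a::euclidean_space set \<Rightarrow> ('a \<Rightarrow> ereal) \<Rightarrow> bool" where
  "subharmonic_on \<omega> v \<longleftrightarrow>
     open \<omega> \<and>
     (\<forall>x\<in>\<omega>. v x < \<infinity>) \<and>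
     usc_on \<omega> v \<and>
     (\<exists>x\<in>\<omega>. v x \<noteq> -\<infinity>) \<and>
     (\<forall>x \<rho>. 0 < \<rho> \<and> cball x \<rho> \<subseteq> \<omega> \<longrightarrow> v x \<le> sphere_mean v x \<rho>)"

definition locally_unbounded_at :: "('a::topological_space \<Rightarrow> ereal) \<Rightarrow> 'a \<Rightarrow> bool" where
  "locally_unbounded_at u x \<longleftrightarrow>
     (\<forall>U. open U \<and> x \<in> U \<longrightarrow> \<not> (\<exists>M::real. \<forall>y\<in>U. u y \<le> ereal M))"

lemma space_sphere_measure [simp]: "space (sphere_measure x r) = sphere x r"
  by (simp add: sphere_measure_def space_scale_measure space_restrict_space)

lemma sets_sphere_measure [measurable_cong]:
  "sets (sphere_measure x r) = sets (restrict_space borel (sphere x r))"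
  by (simp add: sphere_measure_def)

lemma radial_projection_measurable:
  fixes x :: "'a::euclidean_space"
  assumes "0 < r"
  shows "(\<lambda>y. x + (r / dist x y) *\<^sub>R (y - x))
           \<in> restrict_space lborel (ball x r - {x}) \<rightarrow>\<^sub>M restrict_space borel (sphere x r)"
proof (rule measurable_restrict_space2)
  show "(\<lambda>y. x + (r / dist x y) *\<^sub>R (y - x))
          \<in> space (restrict_space lborel (ball x r - {x})) \<rightarrow> sphere x r"
    using assms by (auto simp: space_restrict_space dist_norm norm_minus_commute)
  show "(\<lambda>y. x + (r / dist x y) *\<^sub>R (y - x))
          \<in> restrict_space lborel (ball x r - {x}) \<rightarrow>\<^sub>M borel"
    by (rule measurable_restrict_space1) measurable
qed

lemma emeasure_sphere_measure:
  fixes x :: "'a::euclidean_space"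
  assumes r: "0 < r" and A: "A \<in> sets borel" "A \<subseteq> sphere x r"
  shows "emeasure (sphere_measure x r) A = ennreal (real DIM('a) / r) *
           emeasure lborel {x + t *\<^sub>R (y - x) | y t. y \<in> A \<and> 0 < t \<and> t < 1}"
proof -
  have "A \<in> sets (restrict_space borel (sphere x r))"
    using A by (subst sets_restrict_space_iff) auto
  moreover have "(\<lambda>y. x + (r / dist x y) *\<^sub>R (y - x)) -` A
        \<inter> space (restrict_space lborel (ball x r - {x}))
      = {x + t *\<^sub>R (y - x) | y t. y \<in> A \<and> 0 < t \<and> t < 1}" (is "?L = ?R")
  proof (intro equalityI subsetI)
    fix z assume z: "z \<in> ?L"
    then have "z = x + (dist x z / r) *\<^sub>R ((x + (r / dist x z) *\<^sub>R (z - x)) - x)"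
        "0 < dist x z / r" "dist x z / r < 1"
      using r by (auto simp: space_restrict_space)
    with z show "z \<in> ?R" by blast
  next
    fix z assume "z \<in> ?R"
    then obtain y t where yt: "z = x + t *\<^sub>R (y - x)" "y \<in> A" "0 < t" "t < 1" by blast
    have y: "dist x y = r" using A yt by auto
    have z: "dist x z = t * r" using yt y by (simp add: dist_norm norm_minus_commute)
    then have "x + (r / dist x z) *\<^sub>R (z - x) = y" "0 < dist x z" "dist x z < r"
      using yt r by auto
    with yt show "z \<in> ?L" by (auto simp: space_restrict_space)
  qed
  moreover have "{x + t *\<^sub>R (y - x) | y t. y \<in> A \<and> 0 < t \<and> t < 1} \<subseteq> ball x r - {x}"
    unfolding calculation(2)[symmetric] by (auto simp: space_restrict_space)
  ultimately show ?thesis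
    by (simp add: sphere_measure_def emeasure_distr[OF radial_projection_measurable[OF r]]
        emeasure_restrict_space)
qed

lemma emeasure_sphere_measure_sphere:
  fixes x :: "'a::euclidean_space"
  assumes r: "0 < r"
  shows "emeasure (sphere_measure x r) (sphere x r) =
           ennreal (real DIM('a) * unit_ball_vol (real DIM('a)) * r ^ (DIM('a) - 1))"
proof -
  have "emeasure (sphere_measure x r) (sphere x r)
      = ennreal (real DIM('a) / r) * emeasure lborel (ball x r - {x})"
  proof -
    have "sphere x r \<in> sets (restrict_space borel (sphere x r))"
      by (subst sets_restrict_space_iff) auto
    moreover have "(\<lambda>y. x + (r / dist x y) *\<^sub>R (y - x)) -` sphere x r
        \<inter> space (restrict_space lborel (ball x r - {x})) = ball x r - {x}"
      using r by (auto simp: space_restrict_space dist_norm norm_minus_commute)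
    ultimately show ?thesis
      by (simp add: sphere_measure_def emeasure_distr[OF radial_projection_measurable[OF r]]
          emeasure_restrict_space)
  qed
  also have "emeasure lborel (ball x r - {x}) = emeasure lborel (ball x r)"
    using r by (subst emeasure_Diff) auto
  also have "\<dots> = ennreal (unit_ball_vol (real DIM('a)) * r ^ DIM('a))"
    using r by (simp add: emeasure_ball)
  also have "ennreal (real DIM('a) / r) * \<dots>
      = ennreal (real DIM('a) * unit_ball_vol (real DIM('a)) * r ^ (DIM('a) - 1))"
  proof -
    have "r ^ DIM('a) = r * r ^ (DIM('a) - 1)"
      by (metis DIM_positive power_eq_if less_irrefl)
    then show ?thesis
      using r by (simp add: ennreal_mult[symmetric])
  qed
  finally show ?thesis .
qed

end

theory Submission
  imports Defs
begin

text \<open>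
  Take a sequence of points \<open>a\<^sub>n\<close> of \<open>S\<close> that visits every element of a dense subset infinitely
  often, and points \<open>y\<^sub>n\<close> outside \<open>S\<close> at distance less than \<open>1/(n+1)\<close> from \<open>a\<^sub>n\<close>. Let \<open>K\<^sub>n\<close> consist of
  the points of the ball of radius \<open>n\<close> that lie in \<open>S\<close> or at distance at least \<open>1/(n+1)\<close> from \<open>S\<close>.
  Every point of the space belongs to \<open>K\<^sub>n\<close> for all large \<open>n\<close>. So it is enough to find continuous
  subharmonic \<open>v\<^sub>n \<ge> 0\<close> with \<open>v\<^sub>n = 0\<close> on \<open>K\<^sub>n\<close> and \<open>v\<^sub>n y\<^sub>n > n\<close>: at each point only finitely many of them
  are nonzero, while near each point of \<open>S\<close> their supremum is unbounded.

  The topological hypotheses provide an escape route for \<open>y\<^sub>n\<close>. Let \<open>V\<close> be the component of \<open>a\<^sub>n\<close> in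
  the \<open>1/(n+1)\<close>-neighbourhood of \<open>S\<close>. It contains a component of \<open>S\<close>, hence is unbounded, and so is
  \<open>V - S\<close> because \<open>S\<close> is nowhere dense. Moreover \<open>V - S\<close> is the intersection of the connected open
  sets \<open>V\<close> and \<open>- (S \<inter> V)\<close>, which cover the space; by unicoherence of Euclidean space it is connected
  (\<open>connected_component_minus_closed\<close>). So \<open>y\<^sub>n\<close> lies in an unbounded, connected open set disjoint
  from \<open>K\<^sub>n\<close>.

  Along such a set \<open>W\<close> positivity propagates inwards from infinity. The function
  \<open>max 0 (\<bar>x\<bar>\<^sup>2 - M\<^sup>2)\<close> vanishes on the bounded set \<open>K\<close> and is positive somewhere in \<open>W\<close>. If a continuous
  subharmonic function \<open>v \<ge> 0\<close> vanishing on \<open>K\<close> is positive at \<open>y\<close>, then its maximum with a small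
  multiple of Hopf's barrier \<open>exp (- a \<bar>x - y\<bar>\<^sup>2) - exp (- a R\<^sup>2)\<close> is again such a function, and is
  positive on the ball of radius \<open>R\<close> about \<open>y\<close> (\<open>hopf_barrier_spreads_positivity\<close>). Hence the points of
  \<open>W\<close> at which such functions can be positive form a set open and closed in \<open>W\<close>, which is all of \<open>W\<close>
  (\<open>subharmonic_separation\<close>).

  What makes these gluings easy is a pointwise notion of subharmonicity, \<open>laplacian_nonneg_at\<close>,
  phrased with second differences. It passes to maxima trivially and yields the maximum principle,
  but the sub-mean-value inequality over arbitrary spheres needs an argument
  (\<open>value_le_cone_mean\<close>). Averaging \<open>v\<close> over finitely many rotations changes neither its value at the
  centre nor its mean over the sphere, and the maximum principle applies to every such average.
  Well-chosen averages have a maximum over the sphere arbitrarily close to the mean, so the value at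
  the centre is at most the mean.
\<close>

section \<open>A pointwise condition for subharmonicity\<close>

text \<open>
  For a twice differentiable \<open>v\<close> this says that the Laplacian of \<open>v\<close> is nonnegative at \<open>z\<close>, the sum of
  second differences being \<open>t\<^sup>2\<close> times the Laplacian up to \<open>o(t\<^sup>2)\<close>. For functions with corners the sum
  depends on the orthonormal frame; all frames are admitted so that the condition is invariant under
  rotations.
\<close>
definition laplacian_nonneg_at :: "('a::euclidean_space \<Rightarrow> real) \<Rightarrow> 'a \<Rightarrow> bool" where
  "laplacian_nonneg_at v z \<longleftrightarrow>
     (\<forall>(T :: 'a \<Rightarrow> 'a) \<epsilon>. orthogonal_transformation T \<longrightarrow> 0 < \<epsilon> \<longrightarrow>
        (\<forall>\<^sub>F t in at_right 0.
           - \<epsilon> * t\<^sup>2 \<le> (\<Sum>b\<in>Basis. v (z + t *\<^sub>R T b) + v (z - t *\<^sub>R T b) - 2 * v z)))"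

lemma laplacian_nonneg_atD:
  fixes v :: "'a::euclidean_space \<Rightarrow> real" and T :: "'a \<Rightarrow> 'a"
  assumes "laplacian_nonneg_at v z" "orthogonal_transformation T" "0 < \<epsilon>"
  shows "\<forall>\<^sub>F t in at_right 0.
           - \<epsilon> * t\<^sup>2 \<le> (\<Sum>b\<in>Basis. v (z + t *\<^sub>R T b) + v (z - t *\<^sub>R T b) - 2 * v z)"
  using assms unfolding laplacian_nonneg_at_def by blast

text \<open>
  This gives closure under maxima: where \<open>max v g\<close> equals \<open>v\<close>, the condition is inherited from \<open>v\<close>,
  and elsewhere from \<open>g\<close>.
\<close>
lemma laplacian_nonneg_at_touching:
  fixes v :: "'a::euclidean_space \<Rightarrow> real"
  assumes "laplacian_nonneg_at v z" "\<And>y. v y \<le> w y" "w z = v z"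
  shows "laplacian_nonneg_at w z"
  unfolding laplacian_nonneg_at_def
proof (intro allI impI)
  fix T :: "'a \<Rightarrow> 'a" and \<epsilon> :: real
  assume "orthogonal_transformation T" "0 < \<epsilon>"
  from laplacian_nonneg_atD[OF assms(1) this]
  show "\<forall>\<^sub>F t in at_right 0.
          - \<epsilon> * t\<^sup>2 \<le> (\<Sum>b\<in>Basis. w (z + t *\<^sub>R T b) + w (z - t *\<^sub>R T b) - 2 * w z)"
  proof (rule eventually_mono)
    fix t
    assume "- \<epsilon> * t\<^sup>2 \<le> (\<Sum>b\<in>Basis. v (z + t *\<^sub>R T b) + v (z - t *\<^sub>R T b) - 2 * v z)"
    also have "\<dots> \<le> (\<Sum>b\<in>Basis. w (z + t *\<^sub>R T b) + w (z - t *\<^sub>R T b) - 2 * w z)"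
      using assms(2,3) by (intro sum_mono) (simp add: add_mono)
    finally show "- \<epsilon> * t\<^sup>2 \<le> (\<Sum>b\<in>Basis. w (z + t *\<^sub>R T b) + w (z - t *\<^sub>R T b) - 2 * w z)" .
  qed
qed

lemma laplacian_nonneg_at_const: "laplacian_nonneg_at (\<lambda>_. c) z"
  by (simp add: laplacian_nonneg_at_def)

lemma laplacian_nonneg_at_scale:
  fixes v :: "'a::euclidean_space \<Rightarrow> real"
  assumes "laplacian_nonneg_at v z" "0 \<le> c"
  shows "laplacian_nonneg_at (\<lambda>y. c * v y) z"
proof (cases "c = 0")
  case False
  with assms(2) have c: "0 < c" by simp
  show ?thesis
    unfolding laplacian_nonneg_at_def
  proof (intro allI impI)
    fix T :: "'a \<Rightarrow> 'a" and \<epsilon> :: real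
    assume T: "orthogonal_transformation T" and "0 < \<epsilon>"
    then have "0 < \<epsilon> / c" using c by simp
    from laplacian_nonneg_atD[OF assms(1) T this]
    show "\<forall>\<^sub>F t in at_right 0. - \<epsilon> * t\<^sup>2
            \<le> (\<Sum>b\<in>Basis. c * v (z + t *\<^sub>R T b) + c * v (z - t *\<^sub>R T b) - 2 * (c * v z))"
    proof (rule eventually_mono)
      fix t
      let ?S = "\<Sum>b\<in>Basis. v (z + t *\<^sub>R T b) + v (z - t *\<^sub>R T b) - 2 * v z"
      assume "- (\<epsilon> / c) * t\<^sup>2 \<le> ?S"
      then have "c * (- (\<epsilon> / c) * t\<^sup>2) \<le> c * ?S"
        using c by (intro mult_left_mono) auto
      then show "- \<epsilon> * t\<^sup>2
            \<le> (\<Sum>b\<in>Basis. c * v (z + t *\<^sub>R T b) + c * v (z - t *\<^sub>R T b) - 2 * (c * v z))"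
        using c by (simp add: sum_distrib_left algebra_simps)
    qed
  qed
qed (simp add: laplacian_nonneg_at_const)

lemma laplacian_nonneg_at_add_const:
  fixes v :: "'a::euclidean_space \<Rightarrow> real"
  shows "laplacian_nonneg_at (\<lambda>y. v y + c) z \<longleftrightarrow> laplacian_nonneg_at v z"
  by (simp add: laplacian_nonneg_at_def algebra_simps)

lemma laplacian_nonneg_at_sum:
  fixes f :: "'b \<Rightarrow> 'a::euclidean_space \<Rightarrow> real"
  assumes "finite Q" "\<And>q. q \<in> Q \<Longrightarrow> laplacian_nonneg_at (f q) z"
  shows "laplacian_nonneg_at (\<lambda>y. \<Sum>q\<in>Q. f q y) z"
proof (cases "Q = {}")
  case False
  then have k: "0 < real (card Q)" using assms(1) by (simp add: card_gt_0_iff)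
  show ?thesis
    unfolding laplacian_nonneg_at_def
  proof (intro allI impI)
    fix T :: "'a \<Rightarrow> 'a" and \<epsilon> :: real
    assume T: "orthogonal_transformation T" and "0 < \<epsilon>"
    then have e: "0 < \<epsilon> / card Q" using k by simp
    have "\<forall>\<^sub>F t in at_right 0. \<forall>q\<in>Q. - (\<epsilon> / card Q) * t\<^sup>2
            \<le> (\<Sum>b\<in>Basis. f q (z + t *\<^sub>R T b) + f q (z - t *\<^sub>R T b) - 2 * f q z)"
      using assms laplacian_nonneg_atD[OF _ T e] by (intro eventually_ball_finite) blast+
    then show "\<forall>\<^sub>F t in at_right 0. - \<epsilon> * t\<^sup>2
            \<le> (\<Sum>b\<in>Basis. (\<Sum>q\<in>Q. f q (z + t *\<^sub>R T b)) + (\<Sum>q\<in>Q. f q (z - t *\<^sub>R T b))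
                 - 2 * (\<Sum>q\<in>Q. f q z))"
    proof (rule eventually_mono)
      fix t
      assume "\<forall>q\<in>Q. - (\<epsilon> / card Q) * t\<^sup>2
            \<le> (\<Sum>b\<in>Basis. f q (z + t *\<^sub>R T b) + f q (z - t *\<^sub>R T b) - 2 * f q z)"
      then have "(\<Sum>q\<in>Q. - (\<epsilon> / card Q) * t\<^sup>2)
            \<le> (\<Sum>q\<in>Q. \<Sum>b\<in>Basis. f q (z + t *\<^sub>R T b) + f q (z - t *\<^sub>R T b) - 2 * f q z)"
        by (intro sum_mono) auto
      also have "\<dots> = (\<Sum>b\<in>Basis. \<Sum>q\<in>Q. f q (z + t *\<^sub>R T b) + f q (z - t *\<^sub>R T b) - 2 * f q z)"
        by (rule sum.swap)
      finally show "- \<epsilon> * t\<^sup>2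
            \<le> (\<Sum>b\<in>Basis. (\<Sum>q\<in>Q. f q (z + t *\<^sub>R T b)) + (\<Sum>q\<in>Q. f q (z - t *\<^sub>R T b))
                 - 2 * (\<Sum>q\<in>Q. f q z))"
        using k by (simp add: sum.distrib sum_subtractf sum_distrib_left)
    qed
  qed
qed (simp add: laplacian_nonneg_at_const)

lemma laplacian_nonneg_at_orthogonal:
  fixes v :: "'a::euclidean_space \<Rightarrow> real" and R :: "'a \<Rightarrow> 'a"
  assumes "laplacian_nonneg_at v (R z)" "orthogonal_transformation R"
  shows "laplacian_nonneg_at (\<lambda>y. v (R y)) z"
  unfolding laplacian_nonneg_at_def
proof (intro allI impI)
  fix T :: "'a \<Rightarrow> 'a" and \<epsilon> :: real
  assume T: "orthogonal_transformation T" and e: "0 < \<epsilon>"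
  have RT: "orthogonal_transformation (R \<circ> T)"
    using assms(2) T by (rule orthogonal_transformation_compose)
  have "linear R" using assms(2) by (rule orthogonal_transformation_linear)
  then have R: "R (z + t *\<^sub>R T b) = R z + t *\<^sub>R R (T b)" "R (z - t *\<^sub>R T b) = R z - t *\<^sub>R R (T b)" for t b
    by (simp_all add: linear_add linear_diff linear_scale)
  show "\<forall>\<^sub>F t in at_right 0. - \<epsilon> * t\<^sup>2
          \<le> (\<Sum>b\<in>Basis. v (R (z + t *\<^sub>R T b)) + v (R (z - t *\<^sub>R T b)) - 2 * v (R z))"
    using laplacian_nonneg_atD[OF assms(1) RT e] by (simp add: R)
qed

lemma laplacian_nonneg_at_translation:
  fixes v :: "'a::euclidean_space \<Rightarrow> real"
  assumes "laplacian_nonneg_at v (x + z)"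
  shows "laplacian_nonneg_at (\<lambda>y. v (x + y)) z"
  using assms by (simp add: laplacian_nonneg_at_def algebra_simps)

lemma sum_Basis_orthogonal_inner_square:
  fixes q :: "'a::euclidean_space" and T :: "'a \<Rightarrow> 'a"
  assumes "orthogonal_transformation T"
  shows "(\<Sum>b\<in>Basis. (T b \<bullet> q)\<^sup>2) = (norm q)\<^sup>2"
proof -
  obtain p where p: "q = T p"
    using orthogonal_transformation_surj[OF assms] by (metis surjD)
  have "(\<Sum>b\<in>Basis. (T b \<bullet> q)\<^sup>2) = (\<Sum>b\<in>Basis. (p \<bullet> b)\<^sup>2)"
    using assms by (simp add: p orthogonal_transformation_def inner_commute)
  also have "\<dots> = (norm p)\<^sup>2"
    unfolding power2_norm_eq_inner euclidean_inner[of p p] by (simp add: power2_eq_square)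
  also have "\<dots> = (norm q)\<^sup>2"
    using assms by (simp add: p orthogonal_transformation_norm)
  finally show ?thesis .
qed

lemma norm_orthogonal_Basis:
  fixes b :: "'a::euclidean_space"
  shows "orthogonal_transformation T \<Longrightarrow> b \<in> Basis \<Longrightarrow> norm (T b) = 1"
  by (simp add: orthogonal_transformation_norm)

lemma norm_add_scaleR_square:
  fixes q :: "'a::real_inner"
  shows "(norm (q + t *\<^sub>R e))\<^sup>2 = (norm q)\<^sup>2 + 2 * t * (e \<bullet> q) + t\<^sup>2 * (norm e)\<^sup>2"
  unfolding power2_norm_eq_inner by (simp add: algebra_simps inner_commute power2_eq_square)

lemma laplacian_nonneg_at_norm_square:
  fixes z :: "'a::euclidean_space"
  shows "laplacian_nonneg_at (\<lambda>y. (norm y)\<^sup>2) z"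
  unfolding laplacian_nonneg_at_def
proof (intro allI impI always_eventually)
  fix T :: "'a \<Rightarrow> 'a" and \<epsilon> t :: real
  assume T: "orthogonal_transformation T" and e: "0 < \<epsilon>"
  have *: "(norm (z + t *\<^sub>R T b))\<^sup>2 + (norm (z - t *\<^sub>R T b))\<^sup>2 - 2 * (norm z)\<^sup>2 = 2 * t\<^sup>2"
    if "b \<in> Basis" for b
    using norm_add_scaleR_square[of z t "T b"] norm_add_scaleR_square[of z "-t" "T b"]
      norm_orthogonal_Basis[OF T that] by simp
  show "- \<epsilon> * t\<^sup>2
      \<le> (\<Sum>b\<in>Basis. (norm (z + t *\<^sub>R T b))\<^sup>2 + (norm (z - t *\<^sub>R T b))\<^sup>2 - 2 * (norm z)\<^sup>2)"
  proof -
    have "- \<epsilon> * t\<^sup>2 \<le> 0" using e by simp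
    also have "0 \<le> real DIM('a) * (2 * t\<^sup>2)" by simp
    finally show ?thesis by (simp add: *)
  qed
qed

text \<open>
  The two exponentials arise from the two ends of a second difference of the Gaussian; their
  quadratic growth supplies the positive part of its Laplacian.
\<close>
lemma exp_add_exp_minus_ge: "exp u + exp (- u) \<ge> 2 + u\<^sup>2" for u :: real
proof -
  define f where "f = (\<lambda>u::real. exp u + exp (- u) - u\<^sup>2)"
  have D: "(f has_real_derivative exp x - exp (- x) - 2 * x) (at x)" for x
    unfolding f_def by (auto intro!: derivative_eq_intros)
  have D': "((\<lambda>x. exp x - exp (- x) - 2 * x) has_real_derivative exp x + exp (- x) - 2) (at x)"
    for x :: real by (auto intro!: derivative_eq_intros)
  have ge2: "2 \<le> exp x + exp (- x)" for x :: real
    using exp_ge_add_one_self[of x] exp_ge_add_one_self[of "- x"] by linarith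
  have slope: "0 \<le> exp x - exp (- x) - 2 * x" if "0 \<le> x" for x :: real
  proof -
    have "exp 0 - exp (- 0) - 2 * 0 \<le> exp x - exp (- x) - 2 * x"
    proof (rule DERIV_nonneg_imp_nondecreasing[OF that])
      fix s :: real
      show "\<exists>d. ((\<lambda>x. exp x - exp (- x) - 2 * x) has_real_derivative d) (at s) \<and> 0 \<le> d"
        using D'[of s] ge2[of s] by (intro exI[of _ "exp s + exp (- s) - 2"]) simp
    qed
    then show ?thesis by simp
  qed
  have "f 0 \<le> f \<bar>u\<bar>"
  proof (rule DERIV_nonneg_imp_nondecreasing[of 0 "\<bar>u\<bar>" f])
    fix s :: real assume "0 \<le> s"
    then show "\<exists>d. (f has_real_derivative d) (at s) \<and> 0 \<le> d"
      using D[of s] slope[of s] by blast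
  qed (rule abs_ge_zero)
  then show ?thesis by (cases "0 \<le> u") (auto simp: f_def)
qed

text \<open>
  The Laplacian of \<open>exp (- a \<bar>x - y\<bar>\<^sup>2)\<close> is \<open>2 a (2 a \<bar>x - y\<bar>\<^sup>2 - N) exp (- a \<bar>x - y\<bar>\<^sup>2)\<close>, where \<open>N\<close> is the
  dimension. This is Hopf's substitute for the fundamental solution, and it works uniformly in all
  dimensions.
\<close>
lemma laplacian_nonneg_at_gaussian:
  fixes y z :: "'a::euclidean_space"
  assumes a: "0 < a" and za: "real DIM('a) \<le> 2 * a * (norm (z - y))\<^sup>2"
  shows "laplacian_nonneg_at (\<lambda>x. exp (- a * (norm (x - y))\<^sup>2)) z"
  unfolding laplacian_nonneg_at_def
proof (intro allI impI)
  fix T :: "'a \<Rightarrow> 'a" and \<epsilon> :: real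
  assume T: "orthogonal_transformation T" and e: "0 < \<epsilon>"
  define q where "q = z - y"
  define r where "r = norm q"
  define N where "N = real DIM('a)"
  define E where "E = exp (- a * r\<^sup>2)"
  have E: "0 < E" by (simp add: E_def)
  have pair: "exp (- a * (norm (z + t *\<^sub>R T b - y))\<^sup>2) + exp (- a * (norm (z - t *\<^sub>R T b - y))\<^sup>2)
      \<ge> E * (1 - a * t\<^sup>2) * (2 + 4 * a\<^sup>2 * t\<^sup>2 * (T b \<bullet> q)\<^sup>2)" if "b \<in> Basis" for b t
  proof -
    let ?u = "2 * a * t * (T b \<bullet> q)"
    have eq: "z + t *\<^sub>R T b - y = q + t *\<^sub>R T b" "z - t *\<^sub>R T b - y = q + (-t) *\<^sub>R T b"
      by (simp_all add: q_def)
    have n1: "- a * (norm (z + t *\<^sub>R T b - y))\<^sup>2 = - a * r\<^sup>2 + - a * t\<^sup>2 + - ?u"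
      unfolding eq norm_add_scaleR_square r_def norm_orthogonal_Basis[OF T that]
      by (simp add: algebra_simps)
    have n2: "- a * (norm (z - t *\<^sub>R T b - y))\<^sup>2 = - a * r\<^sup>2 + - a * t\<^sup>2 + ?u"
      unfolding eq norm_add_scaleR_square r_def norm_orthogonal_Basis[OF T that]
      by (simp add: algebra_simps)
    have "E * ((1 - a * t\<^sup>2) * (2 + ?u\<^sup>2)) \<le> E * (exp (- a * t\<^sup>2) * (2 + ?u\<^sup>2))"
      using E exp_ge_add_one_self[of "- a * t\<^sup>2"]
      by (intro mult_left_mono mult_right_mono) auto
    also have "\<dots> \<le> E * (exp (- a * t\<^sup>2) * (exp ?u + exp (- ?u)))"
      using E by (intro mult_left_mono exp_add_exp_minus_ge) auto
    finally show ?thesis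
      unfolding n1 n2 exp_add E_def[symmetric] by (simp add: algebra_simps power_mult_distrib)
  qed
  have sum: "(\<Sum>b\<in>Basis. exp (- a * (norm (z + t *\<^sub>R T b - y))\<^sup>2)
          + exp (- a * (norm (z - t *\<^sub>R T b - y))\<^sup>2) - 2 * exp (- a * (norm (z - y))\<^sup>2))
        \<ge> - (4 * E * a ^ 3 * r\<^sup>2 * t\<^sup>2) * t\<^sup>2" for t
  proof -
    have "- (4 * E * a ^ 3 * r\<^sup>2 * t\<^sup>2) * t\<^sup>2 \<le> - (4 * E * a ^ 3 * r\<^sup>2 * t\<^sup>2) * t\<^sup>2
            + 2 * E * a * t\<^sup>2 * (2 * a * r\<^sup>2 - N)"
      using za a E by (simp add: N_def r_def q_def)
    also have "\<dots> = E * (1 - a * t\<^sup>2) * (N * 2 + 4 * a\<^sup>2 * t\<^sup>2 * r\<^sup>2) - N * (2 * E)"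
      by (simp add: algebra_simps power2_eq_square power3_eq_cube)
    also have "\<dots> = (\<Sum>b\<in>Basis. E * (1 - a * t\<^sup>2) * (2 + 4 * a\<^sup>2 * t\<^sup>2 * (T b \<bullet> q)\<^sup>2) - 2 * E)"
      by (simp add: sum_subtractf sum.distrib sum_distrib_left[symmetric]
          sum_Basis_orthogonal_inner_square[OF T] N_def r_def)
    also have "\<dots> \<le> (\<Sum>b\<in>Basis. exp (- a * (norm (z + t *\<^sub>R T b - y))\<^sup>2)
          + exp (- a * (norm (z - t *\<^sub>R T b - y))\<^sup>2) - 2 * E)"
      by (intro sum_mono diff_right_mono pair)
    finally show ?thesis by (simp add: E_def r_def q_def)
  qed
  have "((\<lambda>t. 4 * E * a ^ 3 * r\<^sup>2 * t\<^sup>2) \<longlongrightarrow> 4 * E * a ^ 3 * r\<^sup>2 * 0\<^sup>2) (at_right 0)"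
    by (intro tendsto_intros)
  then have "\<forall>\<^sub>F t in at_right 0. 4 * E * a ^ 3 * r\<^sup>2 * t\<^sup>2 < \<epsilon>"
    using e by (auto dest: order_tendstoD(2))
  then show "\<forall>\<^sub>F t in at_right 0. - \<epsilon> * t\<^sup>2 \<le> (\<Sum>b\<in>Basis. exp (- a * (norm (z + t *\<^sub>R T b - y))\<^sup>2)
          + exp (- a * (norm (z - t *\<^sub>R T b - y))\<^sup>2) - 2 * exp (- a * (norm (z - y))\<^sup>2))"
  proof (rule eventually_mono)
    fix t :: real
    assume "4 * E * a ^ 3 * r\<^sup>2 * t\<^sup>2 < \<epsilon>"
    then have "- \<epsilon> * t\<^sup>2 \<le> - (4 * E * a ^ 3 * r\<^sup>2 * t\<^sup>2) * t\<^sup>2"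
      by (intro mult_right_mono) auto
    with sum[of t] show "- \<epsilon> * t\<^sup>2 \<le> (\<Sum>b\<in>Basis. exp (- a * (norm (z + t *\<^sub>R T b - y))\<^sup>2)
          + exp (- a * (norm (z - t *\<^sub>R T b - y))\<^sup>2) - 2 * exp (- a * (norm (z - y))\<^sup>2))"
      by linarith
  qed
qed

text \<open>
  If the centre beat the whole sphere, so would it after adding a small multiple of \<open>\<bar>x\<bar>\<^sup>2\<close>. The
  perturbed function would have an interior maximum, where its second differences are at most \<open>0\<close>,
  although the perturbation makes them strictly positive.
\<close>
lemma maximum_principle:
  fixes f :: "'a::euclidean_space \<Rightarrow> real"
  assumes r: "0 < r" and cont: "continuous_on (cball 0 r) f"
    and lap: "\<And>z. z \<in> ball 0 r \<Longrightarrow> laplacian_nonneg_at f z"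
  shows "\<exists>p\<in>sphere 0 r. f 0 \<le> f p"
proof (rule ccontr)
  assume "\<not> ?thesis"
  then have less: "f p < f 0" if "p \<in> sphere 0 r" for p
    using that by (meson not_le)
  have "continuous_on (sphere 0 r) f"
    by (rule continuous_on_subset[OF cont]) auto
  moreover have "sphere (0::'a) r \<noteq> {}" using r by simp
  ultimately obtain p0 where p0: "p0 \<in> sphere 0 r" "\<And>p. p \<in> sphere 0 r \<Longrightarrow> f p \<le> f p0"
    using continuous_attains_sup[OF compact_sphere] by metis
  \<comment> \<open>Half of the largest coefficient for which the perturbation cannot move the maximum to the sphere.\<close>
  define e where "e = (f 0 - f p0) / (2 * r\<^sup>2)"
  have e: "0 < e" "e * r\<^sup>2 < f 0 - f p0"
    using r less[OF p0(1)] by (auto simp: e_def field_simps)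
  define w where "w = (\<lambda>z. f z + e * (norm z)\<^sup>2)"
  have "continuous_on (cball 0 r) w" unfolding w_def by (intro continuous_intros cont)
  then obtain z where z: "z \<in> cball 0 r" "\<And>y. y \<in> cball 0 r \<Longrightarrow> w y \<le> w z"
    using continuous_attains_sup[OF compact_cball, of 0 r w] r by auto
  have "z \<notin> sphere 0 r"
  proof
    assume s: "z \<in> sphere 0 r"
    have "w z = f z + e * r\<^sup>2" using s by (simp add: w_def)
    also have "\<dots> < f 0" using p0(2)[OF s] e by linarith
    also have "\<dots> = w 0" by (simp add: w_def)
    finally show False using z(2)[of 0] r by simp
  qed
  then have zb: "norm z < r" using z(1) by simp
  then have "\<forall>\<^sub>F t in at_right 0. t < r - norm z"
    by (intro eventually_at_rightI[of 0 "r - norm z"]) auto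
  moreover have "\<forall>\<^sub>F t::real in at_right 0. 0 < t" by (rule eventually_at_right_less)
  moreover have "\<forall>\<^sub>F t in at_right 0.
      - e * t\<^sup>2 \<le> (\<Sum>b\<in>Basis. f (z + t *\<^sub>R b) + f (z - t *\<^sub>R b) - 2 * f z)"
    using laplacian_nonneg_atD[OF lap _ e(1), of z "\<lambda>x. x"] zb by auto
  ultimately have "\<forall>\<^sub>F t::real in at_right 0. False"
  proof eventually_elim
    case (elim t)
    have n: "norm (z + t *\<^sub>R b) \<le> r" "norm (z - t *\<^sub>R b) \<le> r" if "b \<in> Basis" for b
      using norm_triangle_ineq[of z "t *\<^sub>R b"] norm_triangle_ineq4[of z "t *\<^sub>R b"] that elim by auto
    have "f (z + t *\<^sub>R b) + f (z - t *\<^sub>R b) - 2 * f z \<le> - (2 * e * t\<^sup>2)" if b: "b \<in> Basis" for b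
    proof -
      have "(norm (z + t *\<^sub>R b))\<^sup>2 + (norm (z - t *\<^sub>R b))\<^sup>2 = 2 * (norm z)\<^sup>2 + 2 * t\<^sup>2"
        using norm_add_scaleR_square[of z t b] norm_add_scaleR_square[of z "-t" b] b by simp
      then have "e * (norm (z + t *\<^sub>R b))\<^sup>2 + e * (norm (z - t *\<^sub>R b))\<^sup>2 = 2 * (e * (norm z)\<^sup>2) + 2 * e * t\<^sup>2"
        by algebra
      moreover have "w (z + t *\<^sub>R b) \<le> w z" "w (z - t *\<^sub>R b) \<le> w z"
        using n[OF b] by (auto intro!: z(2))
      ultimately show ?thesis unfolding w_def by linarith
    qed
    then have "(\<Sum>b\<in>Basis. f (z + t *\<^sub>R b) + f (z - t *\<^sub>R b) - 2 * f z)
        \<le> (\<Sum>b\<in>(Basis::'a set). - (2 * e * t\<^sup>2))"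
      by (rule sum_mono)
    also have "\<dots> = real DIM('a) * - (2 * e * t\<^sup>2)" by simp
    also have "\<dots> \<le> 1 * - (2 * e * t\<^sup>2)"
      using e DIM_positive[where 'a='a] by (intro mult_right_mono_neg) (auto simp: Suc_le_eq)
    finally have "- e * t\<^sup>2 \<le> - (2 * e * t\<^sup>2)" using elim by linarith
    moreover have "0 < e * t\<^sup>2" using e elim by simp
    ultimately show False by simp
  qed
  then show False by simp
qed

section \<open>Means over spheres\<close>

lemma nn_integral_lborel_translation:
  fixes f :: "'a::euclidean_space \<Rightarrow> ennreal"
  assumes [measurable]: "f \<in> borel_measurable borel"
  shows "(\<integral>\<^sup>+ y. f (c + y) \<partial>lborel) = (\<integral>\<^sup>+ y. f y \<partial>lborel)"
proof -
  have "(\<integral>\<^sup>+ y. f y \<partial>lborel) = (\<integral>\<^sup>+ y. f y \<partial>distr lborel borel ((+) c))"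
    by (simp add: lborel_distr_plus)
  also have "\<dots> = (\<integral>\<^sup>+ y. f (c + y) \<partial>lborel)"
    by (subst nn_integral_distr) auto
  finally show ?thesis ..
qed

text \<open>
  Integrate \<open>f (T x + y)\<close> over all \<open>x\<close> and over \<open>y\<close> in the unit ball, in both orders. Translation
  invariance makes one result the volume of the ball times the left-hand side. The other is
  the same volume times the right-hand side, because \<open>T\<close> preserves balls.
\<close>
lemma nn_integral_lborel_orthogonal:
  fixes f :: "'a::euclidean_space \<Rightarrow> ennreal" and T :: "'a \<Rightarrow> 'a"
  assumes f[measurable]: "f \<in> borel_measurable borel" and T: "orthogonal_transformation T"
  shows "(\<integral>\<^sup>+ y. f (T y) \<partial>lborel) = (\<integral>\<^sup>+ y. f y \<partial>lborel)"
proof -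
  have lin: "linear T" using T by (rule orthogonal_transformation_linear)
  then have "continuous_on UNIV T" by (simp add: linear_continuous_on linear_conv_bounded_linear)
  then have Tm[measurable]: "T \<in> borel_measurable borel" by (rule borel_measurable_continuous_onI)
  have norm_T: "norm (T x) = norm x" for x
    using T by (rule orthogonal_transformation_norm)
  define B where "B = ball (0::'a) 1"
  have [measurable]: "B \<in> sets borel" by (simp add: B_def)
  define \<beta> where "\<beta> = emeasure lborel B"
  have \<beta>: "\<beta> \<noteq> 0" "\<beta> \<noteq> \<infinity>"
    using emeasure_lborel_ball_finite[of "0::'a" 1] content_ball_pos[of 1 "0::'a"]
    by (auto simp: \<beta>_def B_def measure_def)
  have "\<beta> * (\<integral>\<^sup>+ x. f (T x) \<partial>lborel) = (\<integral>\<^sup>+ y. \<integral>\<^sup>+ x. f (T x + y) * indicator B y \<partial>lborel \<partial>lborel)"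
  proof -
    have "(\<integral>\<^sup>+ x. f (T x + y) * indicator B y \<partial>lborel)
        = (\<integral>\<^sup>+ x. f (T x) \<partial>lborel) * indicator B y" for y
    proof -
      obtain c where c: "y = T c"
        using orthogonal_transformation_surj[OF T] by (metis surjD)
      have "(\<integral>\<^sup>+ x. f (T x + y) \<partial>lborel) = (\<integral>\<^sup>+ x. f (T (c + x)) \<partial>lborel)"
        by (simp add: c linear_add[OF lin] add.commute)
      also have "\<dots> = (\<integral>\<^sup>+ x. f (T x) \<partial>lborel)"
        by (rule nn_integral_lborel_translation[of "\<lambda>x. f (T x)"]) measurable
      finally show ?thesis by (simp add: nn_integral_multc)
    qed
    then show ?thesis
      by (simp add: nn_integral_cmult_indicator \<beta>_def mult.commute[of "emeasure lborel B"])
  qed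
  also have "\<dots> = (\<integral>\<^sup>+ x. \<integral>\<^sup>+ y. f (T x + y) * indicator B y \<partial>lborel \<partial>lborel)"
    by (rule lborel_pair.Fubini') measurable
  also have "\<dots> = (\<integral>\<^sup>+ x. \<integral>\<^sup>+ y. f y * indicator B (y - T x) \<partial>lborel \<partial>lborel)"
  proof (rule nn_integral_cong)
    fix x
    show "(\<integral>\<^sup>+ y. f (T x + y) * indicator B y \<partial>lborel)
        = (\<integral>\<^sup>+ y. f y * indicator B (y - T x) \<partial>lborel)"
      using nn_integral_lborel_translation[of "\<lambda>y. f y * indicator B (y - T x)" "T x"] by simp
  qed
  also have "\<dots> = (\<integral>\<^sup>+ y. \<integral>\<^sup>+ x. f y * indicator B (y - T x) \<partial>lborel \<partial>lborel)"
    by (rule lborel_pair.Fubini'[symmetric]) measurable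
  also have "\<dots> = (\<integral>\<^sup>+ y. f y * \<beta> \<partial>lborel)"
  proof (rule nn_integral_cong)
    fix y
    obtain c where c: "y = T c"
      using orthogonal_transformation_surj[OF T] by (metis surjD)
    have "(\<integral>\<^sup>+ x. indicator B (y - T x) \<partial>lborel) = (\<integral>\<^sup>+ x. indicator B (- c + x) \<partial>lborel)"
      unfolding c B_def
      by (simp add: indicator_def linear_diff[OF lin, symmetric] norm_T norm_minus_commute)
    also have "\<dots> = \<beta>"
      by (subst nn_integral_lborel_translation) (auto simp: \<beta>_def)
    finally show "(\<integral>\<^sup>+ x. f y * indicator B (y - T x) \<partial>lborel) = f y * \<beta>"
      by (subst nn_integral_cmult) auto
  qed
  also have "\<dots> = \<beta> * (\<integral>\<^sup>+ y. f y \<partial>lborel)"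
    by (simp add: nn_integral_cmult mult.commute)
  finally show ?thesis using \<beta> by (simp add: ennreal_mult_cancel_left)
qed

text \<open>
  The values of \<open>f\<close> on the sphere, extended radially and integrated over the ball. Up to the factor
  \<open>N / r\<close>, with \<open>N\<close> the dimension, this is the surface integral of \<open>f\<close>.
\<close>
definition cone_integral :: "real \<Rightarrow> ('a::euclidean_space \<Rightarrow> real) \<Rightarrow> ennreal" where
  "cone_integral r f = (\<integral>\<^sup>+ y. ennreal (f (r *\<^sub>R sgn y)) * indicator (ball 0 r) y \<partial>lborel)"

lemma radial_retraction_measurable [measurable]:
  "(\<lambda>y::'a::euclidean_space. r *\<^sub>R sgn y) \<in> borel_measurable borel"
  unfolding sgn_div_norm by measurable

lemma cone_integrand_measurable:
  fixes f :: "'a::euclidean_space \<Rightarrow> real"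
  assumes "continuous_on UNIV f"
  shows "(\<lambda>y. ennreal (f (r *\<^sub>R sgn y)) * indicator (ball 0 r) y) \<in> borel_measurable borel"
proof -
  have [measurable]: "f \<in> borel_measurable borel"
    using assms by (rule borel_measurable_continuous_onI)
  have [measurable]: "ball (0::'a) r \<in> sets borel" by simp
  show ?thesis by measurable
qed

lemma cone_integral_orthogonal:
  fixes f :: "'a::euclidean_space \<Rightarrow> real" and T :: "'a \<Rightarrow> 'a"
  assumes "continuous_on UNIV f" and T: "orthogonal_transformation T"
  shows "cone_integral r (\<lambda>y. f (T y)) = cone_integral r f"
proof -
  have "linear T" using T by (rule orthogonal_transformation_linear)
  then have "T (r *\<^sub>R sgn y) = r *\<^sub>R sgn (T y)" for y
    by (simp add: sgn_div_norm linear_scale orthogonal_transformation_norm[OF T])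
  moreover have "indicator (ball 0 r) (T y) = (indicator (ball 0 r) y :: ennreal)" for y
    by (simp add: indicator_def orthogonal_transformation_norm[OF T])
  ultimately show ?thesis
    unfolding cone_integral_def
    using nn_integral_lborel_orthogonal[OF cone_integrand_measurable[OF assms(1), of r] T]
    by simp
qed

text \<open>
  Together with invariance under rotations, this shows that averaging over rotations leaves
  the surface integral unchanged.
\<close>
lemma cone_integral_mean:
  fixes f :: "'q \<Rightarrow> 'a::euclidean_space \<Rightarrow> real"
  assumes Q: "finite Q" "Q \<noteq> {}" and cont: "\<And>q. q \<in> Q \<Longrightarrow> continuous_on UNIV (f q)"
    and nonneg: "\<And>q y. q \<in> Q \<Longrightarrow> 0 \<le> f q y"
    and eq: "\<And>q. q \<in> Q \<Longrightarrow> cone_integral r (f q) = A"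
  shows "cone_integral r (\<lambda>y. (\<Sum>q\<in>Q. f q y) / card Q) = A"
proof -
  have k: "0 < real (card Q)" using Q by (simp add: card_gt_0_iff)
  have "cone_integral r (\<lambda>y. (\<Sum>q\<in>Q. f q y) / card Q)
      = (\<integral>\<^sup>+ y. (\<Sum>q\<in>Q. ennreal (1 / card Q) * (ennreal (f q (r *\<^sub>R sgn y)) * indicator (ball 0 r) y)) \<partial>lborel)"
    unfolding cone_integral_def
  proof (rule nn_integral_cong)
    fix y :: 'a
    have "ennreal ((\<Sum>q\<in>Q. f q (r *\<^sub>R sgn y)) / card Q)
        = (\<Sum>q\<in>Q. ennreal (1 / card Q) * ennreal (f q (r *\<^sub>R sgn y)))"
    proof -
      have "(\<Sum>q\<in>Q. ennreal (1 / card Q) * ennreal (f q (r *\<^sub>R sgn y)))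
          = (\<Sum>q\<in>Q. ennreal (f q (r *\<^sub>R sgn y) / card Q))"
        using nonneg k by (intro sum.cong refl) (simp add: ennreal_mult[symmetric])
      also have "\<dots> = ennreal (\<Sum>q\<in>Q. f q (r *\<^sub>R sgn y) / card Q)"
        using nonneg k by (intro sum_ennreal) auto
      finally show ?thesis by (simp add: sum_divide_distrib)
    qed
    then show "ennreal ((\<Sum>q\<in>Q. f q (r *\<^sub>R sgn y)) / card Q) * indicator (ball 0 r) y
        = (\<Sum>q\<in>Q. ennreal (1 / card Q) * (ennreal (f q (r *\<^sub>R sgn y)) * indicator (ball 0 r) y))"
      by (simp add: sum_distrib_right mult.assoc)
  qed
  also have "\<dots> = (\<Sum>q\<in>Q. ennreal (1 / card Q) * A)"
  proof (subst nn_integral_sum)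
    fix q assume "q \<in> Q"
    note m = cone_integrand_measurable[OF cont[OF this], of r]
    show "(\<lambda>y. ennreal (1 / card Q) * (ennreal (f q (r *\<^sub>R sgn y)) * indicator (ball 0 r) y))
        \<in> borel_measurable lborel"
      using m by measurable
  next
    show "(\<Sum>q\<in>Q. \<integral>\<^sup>+ y. ennreal (1 / card Q) * (ennreal (f q (r *\<^sub>R sgn y)) * indicator (ball 0 r) y) \<partial>lborel)
       = (\<Sum>q\<in>Q. ennreal (1 / card Q) * A)"
      using cone_integrand_measurable[OF cont, of _ r] eq
      by (intro sum.cong refl) (simp add: nn_integral_cmult cone_integral_def)
  qed
  also have "\<dots> = ennreal (card Q) * ennreal (1 / card Q) * A"
    by (simp add: ennreal_of_nat_eq_real_of_nat mult.assoc)
  also have "ennreal (card Q) * ennreal (1 / card Q) = 1"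
    using k by (simp add: ennreal_mult[symmetric])
  finally show ?thesis by simp
qed

lemma cone_integral_ge:
  fixes f :: "'a::euclidean_space \<Rightarrow> real"
  assumes r: "0 < r" and c: "\<And>p. p \<in> sphere 0 r \<Longrightarrow> c \<le> f p"
  shows "ennreal c * emeasure lborel (ball (0::'a) r) \<le> cone_integral r f"
proof -
  have "ennreal c * emeasure lborel (ball (0::'a) r)
      = (\<integral>\<^sup>+ y. ennreal c * indicator (ball (0::'a) r) y \<partial>lborel)"
    by (subst nn_integral_cmult_indicator) auto
  also have "\<dots> \<le> cone_integral r f"
    unfolding cone_integral_def
  proof (rule nn_integral_mono_AE)
    have "AE y in lborel. y \<noteq> (0::'a)" by (rule AE_lborel_singleton)
    then show "AE y in lborel. ennreal c * indicator (ball (0::'a) r) y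
        \<le> ennreal (f (r *\<^sub>R sgn y)) * indicator (ball 0 r) y"
    proof eventually_elim
      case (elim y)
      then have "c \<le> f (r *\<^sub>R sgn y)" using r by (intro c) (simp add: norm_sgn)
      then show ?case by (intro mult_right_mono ennreal_leI) auto
    qed
  qed
  finally show ?thesis .
qed

lemma emeasure_ball_pos_finite:
  assumes "0 < r"
  shows "emeasure lborel (ball (x::'a::euclidean_space) r) \<noteq> 0"
    "emeasure lborel (ball (x::'a::euclidean_space) r) \<noteq> \<infinity>"
  using emeasure_lborel_ball_finite[of x r] content_ball_pos[OF assms, of x]
  by (auto simp: measure_def)

lemma uniform_modulus_on_sphere:
  fixes f :: "'a::euclidean_space \<Rightarrow> real"
  assumes "continuous_on UNIV f" "0 < \<kappa>"
  obtains \<delta> where "0 < \<delta>"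
    "\<And>p q. p \<in> sphere 0 r \<Longrightarrow> q \<in> sphere 0 r \<Longrightarrow> dist p q < \<delta> \<Longrightarrow> f q \<le> f p + \<kappa>"
proof -
  have "uniformly_continuous_on (sphere 0 r) f"
    using assms(1) by (intro compact_uniformly_continuous) (auto intro: continuous_on_subset)
  then obtain \<delta> where "0 < \<delta>"
      "\<And>p q. p \<in> sphere 0 r \<Longrightarrow> q \<in> sphere 0 r \<Longrightarrow> dist q p < \<delta> \<Longrightarrow> dist (f q) (f p) < \<kappa>"
    using assms(2) unfolding uniformly_continuous_on_def by metis
  then show ?thesis
    by (intro that[of \<delta>]) (force simp: dist_commute dist_real_def abs_less_iff)+
qed

text \<open>
  Suppose that the mean \<open>a\<close> of \<open>v\<close> over the sphere is less than \<open>v 0\<close>. Consider the class \<open>F\<close> of functions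
  satisfying the pointwise condition that agree with \<open>v\<close> at \<open>0\<close> and in mean, and share its modulus of
  continuity on the sphere at one scale. By the maximum principle the maxima of members of \<open>F\<close> over the
  sphere have an infimum \<open>m \<ge> v 0 > a\<close>. A nearly optimal member is about \<open>a\<close> or less at some point, hence
  clearly below \<open>m\<close> on a cap whose size does not depend on the member. Averaging over finitely many
  rotations that carry this cap around the sphere gives a member of \<open>F\<close> with maximum less than \<open>m\<close>.
\<close>
lemma value_le_cone_mean:
  fixes v :: "real ^ 'n \<Rightarrow> real"
  assumes r: "0 < r" and cont: "continuous_on UNIV v" and nonneg: "\<And>z. 0 \<le> v z"
    and lap: "\<And>z. laplacian_nonneg_at v z"
  shows "ennreal (v 0) * emeasure lborel (ball (0 :: real ^ 'n) r) \<le> cone_integral r v"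
proof (rule ccontr)
  define V where "V = emeasure lborel (ball (0 :: real ^ 'n) r)"
  have V: "V \<noteq> 0" "V \<noteq> \<infinity>" unfolding V_def by (rule emeasure_ball_pos_finite[OF r])+
  assume "\<not> ?thesis"
  then have less: "cone_integral r v < ennreal (v 0) * V" by (simp add: V_def)
  define a where "a = enn2real (cone_integral r v / V)"
  have "cone_integral r v / V < ennreal (v 0)"
    using less V by (simp add: divide_less_ennreal mult.commute top.not_eq_extremum zero_less_iff_neq_zero)
  moreover from this have a_eq: "ennreal a = cone_integral r v / V"
    unfolding a_def by (intro ennreal_enn2real) (metis ennreal_less_top less_trans)
  moreover have "ennreal a * V = cone_integral r v"
    unfolding a_eq using V by (simp add: ennreal_divide_times top.not_eq_extremum)
  moreover have "0 \<le> a" by (simp add: a_def)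
  ultimately have a: "0 \<le> a" "a < v 0" "cone_integral r v = ennreal a * V"
    by (simp_all flip: ennreal_less_iff)
  \<comment> \<open>The gap is split in three: the excess over the mean at the low point, the oscillation on a cap, and the final gain.\<close>
  define \<kappa> where "\<kappa> = (v 0 - a) / 3"
  have \<kappa>: "0 < \<kappa>" "v 0 = a + 3 * \<kappa>" using a(2) by (simp_all add: \<kappa>_def field_simps)
  obtain \<delta> where \<delta>: "0 < \<delta>"
      "\<And>p q. p \<in> sphere 0 r \<Longrightarrow> q \<in> sphere 0 r \<Longrightarrow> dist p q < \<delta> \<Longrightarrow> v q \<le> v p + \<kappa>"
    using uniform_modulus_on_sphere[OF cont \<kappa>(1)] by metis
  define F where "F = {f :: real ^ 'n \<Rightarrow> real. continuous_on UNIV f \<and> (\<forall>z. 0 \<le> f z) \<and> (\<forall>z. laplacian_nonneg_at f z)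
      \<and> f 0 = v 0 \<and> cone_integral r f = cone_integral r v
      \<and> (\<forall>p\<in>sphere 0 r. \<forall>q\<in>sphere 0 r. dist p q < \<delta> \<longrightarrow> f q \<le> f p + \<kappa>)}"
  have vF: "v \<in> F" unfolding F_def using cont nonneg lap \<delta> by blast
  define top where "top f = Sup (f ` sphere 0 r)" for f :: "real ^ 'n \<Rightarrow> real"
  have ne: "sphere (0 :: real ^ 'n) r \<noteq> {}" using r by simp
  have top_upper: "f p \<le> top f" if "f \<in> F" "p \<in> sphere 0 r" for f p
  proof -
    have "compact (f ` sphere 0 r)"
      using that(1) by (intro compact_continuous_image) (auto simp: F_def intro: continuous_on_subset)
    then show ?thesis
      unfolding top_def using that(2) by (intro cSup_upper) (auto intro: bounded_imp_bdd_above compact_imp_bounded)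
  qed
  have top_least: "top f \<le> c" if "\<And>p. p \<in> sphere 0 r \<Longrightarrow> f p \<le> c" for f c
    unfolding top_def using that ne by (intro cSup_least) auto
  have top_ge: "v 0 \<le> top f" if f: "f \<in> F" for f
  proof -
    have "continuous_on (cball 0 r) f"
      using f by (auto simp: F_def intro: continuous_on_subset)
    then obtain p where p: "p \<in> sphere 0 r" "f 0 \<le> f p"
      using maximum_principle[OF r, of f] f by (auto simp: F_def)
    have "f 0 = v 0" using f by (simp add: F_def)
    then show ?thesis using p(2) top_upper[OF f p(1)] by linarith
  qed
  define m where "m = Inf (top ` F)"
  have bdd: "bdd_below (top ` F)" using top_ge by (intro bdd_belowI[of _ "v 0"]) auto
  have m_le: "m \<le> top f" if "f \<in> F" for f
    unfolding m_def using that bdd by (intro cInf_lower) auto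
  have m_ge: "v 0 \<le> m"
    unfolding m_def using vF top_ge by (intro cInf_greatest) auto
  have "sphere (0 :: real ^ 'n) r \<subseteq> (\<Union>q\<in>sphere 0 r. ball q \<delta>)"
    using \<delta>(1) by force
  then obtain Q where Q: "Q \<subseteq> sphere 0 r" "finite Q" "sphere (0 :: real ^ 'n) r \<subseteq> (\<Union>q\<in>Q. ball q \<delta>)"
    by (rule compactE_image[OF compact_sphere open_ball])
  have Qne: "Q \<noteq> {}" using Q(3) ne by auto
  define k where "k = real (card Q)"
  have k: "0 < k" using Q(2) Qne by (simp add: k_def card_gt_0_iff)
  \<comment> \<open>One of the \<open>k\<close> rotated copies gains \<open>\<kappa>\<close>, so the average gains \<open>\<kappa> / k\<close>; the defect \<open>\<eta>\<close> must be smaller.\<close>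
  define \<eta> where "\<eta> = \<kappa> / (2 * k)"
  have \<eta>: "0 < \<eta>" "k * \<eta> < \<kappa>" using \<kappa> k by (auto simp: \<eta>_def)
  have "\<exists>f\<in>F. top f < m + \<eta>"
    using cInf_lessD[of "top ` F" "m + \<eta>"] vF \<eta>(1) by (auto simp: m_def)
  then obtain f where f: "f \<in> F" "top f < m + \<eta>" by blast
  have f_cont: "continuous_on UNIV f" and f_nonneg: "0 \<le> f z" and f_lap: "laplacian_nonneg_at f z"
    and f_0: "f 0 = v 0" and f_cone: "cone_integral r f = cone_integral r v"
    and f_mod: "s \<in> sphere 0 r \<Longrightarrow> t \<in> sphere 0 r \<Longrightarrow> dist s t < \<delta> \<Longrightarrow> f t \<le> f s + \<kappa>" for z s t
    using f(1) unfolding F_def by blast+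
  have "\<exists>p\<in>sphere 0 r. f p \<le> a + \<kappa>"
  proof (rule ccontr)
    assume "\<not> ?thesis"
    then have "a + \<kappa> \<le> f p" if "p \<in> sphere 0 r" for p
      using that by (meson linear)
    then have "ennreal (a + \<kappa>) * V \<le> cone_integral r f"
      unfolding V_def by (rule cone_integral_ge[OF r])
    also have "\<dots> = ennreal a * V" using f_cone a(3) by simp
    finally have "ennreal (a + \<kappa>) \<le> ennreal a"
      using V ennreal_mult_le_mult_iff[of V "ennreal (a + \<kappa>)" "ennreal a"]
      by (simp add: mult.commute[of V])
    then show False using a(1) \<kappa>(1) by (simp add: ennreal_le_iff)
  qed
  then obtain p where p: "p \<in> sphere 0 r" "f p \<le> a + \<kappa>" by blast
  have "\<exists>T. orthogonal_transformation T \<and> T q = p" if "q \<in> Q" for q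
    using orthogonal_transformation_exists[of q p] that Q(1) p(1) by (metis mem_sphere_0 subsetD)
  then obtain T where T: "\<And>q. q \<in> Q \<Longrightarrow> orthogonal_transformation (T q)" "\<And>q. q \<in> Q \<Longrightarrow> T q q = p"
    by metis
  have linT: "linear (T q)" if "q \<in> Q" for q
    using T(1)[OF that] by (rule orthogonal_transformation_linear)
  have normT: "norm (T q s) = norm s" if "q \<in> Q" for q s
    using T(1)[OF that] by (rule orthogonal_transformation_norm)
  have Tsphere: "T q s \<in> sphere 0 r" if "q \<in> Q" "s \<in> sphere 0 r" for q s
    using that normT by simp
  have Tdist: "dist (T q s) (T q t) = dist s t" if "q \<in> Q" for q s t
    by (simp add: dist_norm linT[OF that] normT[OF that] flip: linear_diff)
  define g where "g = (\<lambda>z. (\<Sum>q\<in>Q. f (T q z)) / k)"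
  have contT: "continuous_on UNIV (\<lambda>z. f (T q z))" if "q \<in> Q" for q
  proof -
    have "continuous_on UNIV (T q)"
      using linT[OF that] by (simp add: linear_continuous_on linear_conv_bounded_linear)
    then show ?thesis
      by (intro continuous_on_compose2[OF f_cont]) auto
  qed
  have T0: "T q 0 = 0" if "q \<in> Q" for q
    using linT[OF that] by (rule linear_0)
  have gF: "g \<in> F"
    unfolding F_def
  proof (intro CollectI conjI allI ballI impI)
    show "continuous_on UNIV g"
      unfolding g_def using contT k by (intro continuous_intros) auto
    show "0 \<le> g z" for z
      unfolding g_def using k by (intro divide_nonneg_nonneg sum_nonneg f_nonneg) auto
    show "laplacian_nonneg_at g z" for z
    proof -
      have "laplacian_nonneg_at (\<lambda>z. \<Sum>q\<in>Q. f (T q z)) z"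
        by (rule laplacian_nonneg_at_sum[OF Q(2) laplacian_nonneg_at_orthogonal[OF f_lap T(1)]])
      from laplacian_nonneg_at_scale[OF this, of "1 / k"] k show ?thesis
        by (simp add: g_def)
    qed
    show "g 0 = v 0"
      using k T0 f_0 by (simp add: g_def k_def)
    have "cone_integral r g = cone_integral r f"
      unfolding g_def k_def
      by (rule cone_integral_mean[OF Q(2) Qne contT f_nonneg cone_integral_orthogonal[OF f_cont T(1)]])
    then show "cone_integral r g = cone_integral r v" by (simp add: f_cone)
    fix s t :: "real ^ 'n" assume st: "s \<in> sphere 0 r" "t \<in> sphere 0 r" "dist s t < \<delta>"
    have "(\<Sum>q\<in>Q. f (T q t)) \<le> (\<Sum>q\<in>Q. f (T q s) + \<kappa>)"
      using st Tsphere Tdist by (intro sum_mono f_mod) auto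
    then have "(\<Sum>q\<in>Q. f (T q t)) \<le> (\<Sum>q\<in>Q. f (T q s)) + k * \<kappa>"
      by (simp add: sum.distrib k_def)
    then show "g t \<le> g s + \<kappa>" using k by (simp add: g_def field_simps)
  qed
  have "g s \<le> m + \<eta> - \<kappa> / k" if s: "s \<in> sphere 0 r" for s
  proof -
    obtain q0 where q0: "q0 \<in> Q" "dist q0 s < \<delta>" using Q(3) s by (auto simp: subset_iff)
    have "dist p (T q0 s) < \<delta>" using Tdist[OF q0(1), of q0 s] T(2)[OF q0(1)] q0(2) by simp
    then have "f (T q0 s) \<le> f p + \<kappa>"
      by (rule f_mod[OF p(1) Tsphere[OF q0(1) s]])
    then have near: "f (T q0 s) \<le> m + \<eta> - \<kappa>" using p(2) \<kappa>(2) m_ge \<eta>(1) by linarith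
    have far: "f (T q s) \<le> m + \<eta>" if "q \<in> Q" for q
      using top_upper[OF f(1) Tsphere[OF that s]] f(2) by linarith
    have "(\<Sum>q\<in>Q. f (T q s)) = f (T q0 s) + (\<Sum>q\<in>Q - {q0}. f (T q s))"
      using Q(2) q0(1) by (rule sum.remove)
    also have "\<dots> \<le> (m + \<eta> - \<kappa>) + (\<Sum>q\<in>Q - {q0}. m + \<eta>)"
      using near far by (intro add_mono sum_mono) auto
    also have "(\<Sum>q\<in>Q - {q0}. m + \<eta>) = (\<Sum>q\<in>Q. m + \<eta>) - (m + \<eta>)"
      using sum.remove[OF Q(2) q0(1), of "\<lambda>_. m + \<eta>"] by linarith
    finally have "(\<Sum>q\<in>Q. f (T q s)) \<le> k * (m + \<eta>) - \<kappa>" by (simp add: k_def)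
    then show ?thesis using k by (simp add: g_def field_simps)
  qed
  then have "top g \<le> m + \<eta> - \<kappa> / k" by (rule top_least)
  moreover have "\<eta> < \<kappa> / k" using \<eta>(2) k by (simp add: field_simps)
  ultimately show False using m_le[OF gF] by linarith
qed

lemma nn_integral_sphere_measure:
  fixes v :: "'a::euclidean_space \<Rightarrow> real"
  assumes r: "0 < r" and cont: "continuous_on UNIV v"
  shows "(\<integral>\<^sup>+ y. ennreal (v y) \<partial>sphere_measure x r)
    = ennreal (real DIM('a) / r) * cone_integral r (\<lambda>y. v (x + y))"
proof -
  have [measurable]: "v \<in> borel_measurable borel"
    using cont by (rule borel_measurable_continuous_onI)
  let ?B = "ball x r - {x}"
  have [measurable]: "?B \<in> sets borel" by simp
  let ?\<pi> = "\<lambda>y. x + (r / dist x y) *\<^sub>R (y - x)"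
  have "(\<integral>\<^sup>+ y. ennreal (v y) \<partial>sphere_measure x r)
     = ennreal (real DIM('a) / r) * (\<integral>\<^sup>+ y. ennreal (v y)
         \<partial>distr (restrict_space lborel ?B) (restrict_space borel (sphere x r)) ?\<pi>)"
    unfolding sphere_measure_def
    by (rule nn_integral_scale_measure) (auto intro!: measurable_restrict_space1)
  also have "(\<integral>\<^sup>+ y. ennreal (v y)
         \<partial>distr (restrict_space lborel ?B) (restrict_space borel (sphere x r)) ?\<pi>)
      = (\<integral>\<^sup>+ y. ennreal (v (?\<pi> y)) \<partial>restrict_space lborel ?B)"
    by (rule nn_integral_distr[OF radial_projection_measurable[OF r]])
       (auto intro!: measurable_restrict_space1)
  also have "\<dots> = (\<integral>\<^sup>+ y. ennreal (v (?\<pi> y)) * indicator ?B y \<partial>lborel)"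
    by (rule nn_integral_restrict_space) auto
  also have "\<dots> = (\<integral>\<^sup>+ y. ennreal (v (?\<pi> (x + y))) * indicator ?B (x + y) \<partial>lborel)"
    by (rule nn_integral_lborel_translation[symmetric]) measurable
  also have "\<dots> = cone_integral r (\<lambda>y. v (x + y))"
    unfolding cone_integral_def
  proof (rule nn_integral_cong_AE)
    have "AE y in lborel. y \<noteq> (0::'a)" by (rule AE_lborel_singleton)
    then show "AE y in lborel. ennreal (v (?\<pi> (x + y))) * indicator ?B (x + y)
        = ennreal (v (x + r *\<^sub>R sgn y)) * indicator (ball 0 r) y"
      by eventually_elim (simp add: indicator_def dist_norm sgn_div_norm divide_inverse)
  qed
  finally show ?thesis .
qed

text \<open>
  Nonnegativity makes the negative part in the definition of the spherical mean vanish.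
\<close>
lemma subharmonic_on_UNIV_of_laplacian_nonneg:
  fixes v :: "real ^ 'n \<Rightarrow> real"
  assumes cont: "continuous_on UNIV v" and nonneg: "\<And>z. 0 \<le> v z"
    and lap: "\<And>z. laplacian_nonneg_at v z"
  shows "subharmonic_on UNIV (\<lambda>x. ereal (v x))"
  unfolding subharmonic_on_def
proof (intro conjI ballI allI impI)
  show "usc_on UNIV (\<lambda>x. ereal (v x))"
    unfolding usc_on_def
  proof (intro ballI allI impI)
    fix x c assume "ereal (v x) < c"
    moreover have "((\<lambda>y. ereal (v y)) \<longlongrightarrow> ereal (v x)) (at x)"
      using cont by (simp add: continuous_on_def)
    ultimately show "\<forall>\<^sub>F y in at x within UNIV. ereal (v y) < c"
      using order_tendstoD(2) by blast
  qed
  show "\<exists>x\<in>UNIV. ereal (v x) \<noteq> - \<infinity>" by simp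
  fix x :: "real ^ 'n" and \<rho> :: real
  assume "0 < \<rho> \<and> cball x \<rho> \<subseteq> UNIV"
  then have r: "0 < \<rho>" by simp
  define V where "V = emeasure lborel (ball (0 :: real ^ 'n) \<rho>)"
  have V: "V \<noteq> 0" "V \<noteq> \<infinity>" unfolding V_def by (rule emeasure_ball_pos_finite[OF r])+
  define c where "c = ennreal (real DIM(real ^ 'n) / \<rho>)"
  have c: "c \<noteq> 0" "c \<noteq> \<infinity>" using r by (auto simp: c_def)
  define J where "J = (\<integral>\<^sup>+ y. ennreal (v y) \<partial>sphere_measure x \<rho>)"
  have contx: "continuous_on UNIV (\<lambda>y. v (x + y))"
    by (intro continuous_on_compose2[OF cont] continuous_intros) auto
  have "ennreal (v (x + 0)) * V \<le> cone_integral \<rho> (\<lambda>y. v (x + y))"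
    unfolding V_def
    by (intro value_le_cone_mean[OF r contx] nonneg laplacian_nonneg_at_translation lap)
  then have "c * (ennreal (v x) * V) \<le> c * cone_integral \<rho> (\<lambda>y. v (x + y))"
    by (intro mult_left_mono) auto
  then have J: "ennreal (v x) * (c * V) \<le> J"
    unfolding J_def nn_integral_sphere_measure[OF r cont] c_def by (simp add: mult_ac)
  have M: "emeasure (sphere_measure x \<rho>) (sphere x \<rho>) = c * V"
  proof -
    have "emeasure (sphere_measure x \<rho>) (sphere x \<rho>)
        = (\<integral>\<^sup>+ y. ennreal ((\<lambda>_. 1) y) \<partial>sphere_measure x \<rho>)"
      by simp
    also have "\<dots> = c * V"
      unfolding nn_integral_sphere_measure[OF r continuous_on_const] c_def V_def cone_integral_def
      by simp
    finally show ?thesis .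
  qed
  have "ereal (v x) * enn2ereal (c * V) \<le> enn2ereal J"
  proof -
    have "ereal (v x) * enn2ereal (c * V) = enn2ereal (ennreal (v x) * (c * V))"
      using nonneg by (simp add: times_ennreal.rep_eq enn2ereal_ennreal)
    then show ?thesis using J by (simp add: less_eq_ennreal.rep_eq)
  qed
  moreover have "0 < enn2ereal (c * V)" "enn2ereal (c * V) < \<infinity>"
    using c V by (auto simp: zero_ennreal.rep_eq[symmetric] less_ennreal.rep_eq[symmetric]
        top_ennreal.rep_eq[symmetric] zero_less_iff_neq_zero ennreal_mult_less_top less_top)
  ultimately have "ereal (v x) \<le> enn2ereal J / enn2ereal (c * V)"
    by (simp add: ereal_le_divide_pos mult.commute)
  moreover have "(\<integral>\<^sup>+ y. e2ennreal (- ereal (v y)) \<partial>sphere_measure x \<rho>) = 0"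
    using nonneg by (simp add: ennreal_neg)
  ultimately show "ereal (v x) \<le> sphere_mean (\<lambda>x. ereal (v x)) x \<rho>"
    unfolding sphere_mean_def M J_def by (simp add: zero_ennreal.rep_eq e2ennreal_ereal)
qed auto

section \<open>Spreading positivity\<close>

text \<open>
  The new function is the maximum of \<open>v\<close> and a multiple of Hopf's barrier for a large exponent \<open>a\<close>.
  The barrier may violate the Laplacian condition only near \<open>y\<close>; there \<open>v\<close> is bounded below by a positive
  constant, and the barrier is scaled to stay below that constant, so that it is not seen by the
  maximum. Outside the ball of radius \<open>R\<close> the barrier is negative or zero.
\<close>
lemma hopf_barrier_spreads_positivity:
  fixes v :: "'a::euclidean_space \<Rightarrow> real"
  assumes cont: "continuous_on UNIV v" and nonneg: "\<And>x. 0 \<le> v x"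
    and lap: "\<And>x. laplacian_nonneg_at v x" and pos: "0 < v y" and R: "0 < R"
  obtains w where "continuous_on UNIV w" "\<And>x. 0 \<le> w x" "\<And>x. laplacian_nonneg_at w x"
    "\<And>x. x \<in> ball y R \<Longrightarrow> 0 < w x" "\<And>x. x \<notin> ball y R \<Longrightarrow> w x = v x"
proof -
  define d where "d = v y / 2"
  have d: "0 < d" using pos by (simp add: d_def)
  have "open {x. d < v x}"
    using cont by (intro open_Collect_less) auto
  moreover have "y \<in> {x. d < v x}" using pos by (simp add: d_def)
  ultimately obtain s where s: "0 < s" "ball y s \<subseteq> {x. d < v x}"
    by (meson openE)
  \<comment> \<open>The least exponent for which the Gaussian has nonnegative Laplacian outside the ball of radius \<open>s\<close>.\<close>
  define a where "a = real DIM('a) / (2 * s\<^sup>2)"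
  have a: "0 < a" using s by (simp add: a_def)
  define h where "h = (\<lambda>x. exp (- a * (norm (x - y))\<^sup>2))"
  define g where "g = (\<lambda>x. d * h x + - (d * exp (- a * R\<^sup>2)))"
  define w where "w = (\<lambda>x. max (v x) (g x))"
  have g_less: "g x < d" for x
  proof -
    have "h x \<le> 1" using a by (simp add: h_def)
    then have "d * h x \<le> d * 1" using d by (intro mult_left_mono) auto
    moreover have "0 < d * exp (- a * R\<^sup>2)" using d by simp
    ultimately show ?thesis by (simp add: g_def)
  qed
  have lap_g: "laplacian_nonneg_at g x" if "x \<notin> ball y s" for x
  proof -
    have "s \<le> norm (x - y)" using that by (simp add: dist_norm norm_minus_commute)
    then have "s\<^sup>2 \<le> (norm (x - y))\<^sup>2" using s(1) by (intro power_mono) auto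
    then have "2 * a * s\<^sup>2 \<le> 2 * a * (norm (x - y))\<^sup>2" using a by simp
    moreover have "2 * a * s\<^sup>2 = real DIM('a)" using s(1) by (simp add: a_def)
    ultimately have "laplacian_nonneg_at h x"
      unfolding h_def by (intro laplacian_nonneg_at_gaussian a) simp
    then show ?thesis
      unfolding g_def laplacian_nonneg_at_add_const
      using d by (intro laplacian_nonneg_at_scale) auto
  qed
  have g_outside: "g x \<le> 0" if "x \<notin> ball y R" for x
  proof -
    have "R \<le> norm (x - y)" using that by (simp add: dist_norm norm_minus_commute)
    then have "R\<^sup>2 \<le> (norm (x - y))\<^sup>2" using R by (intro power_mono) auto
    then have "h x \<le> exp (- a * R\<^sup>2)" using a by (simp add: h_def)
    then show ?thesis using d by (simp add: g_def)
  qed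
  have g_inside: "0 < g x" if "x \<in> ball y R" for x
  proof -
    have "norm (x - y) < R" using that by (simp add: dist_norm norm_minus_commute)
    then have "(norm (x - y))\<^sup>2 < R\<^sup>2" by (intro power_strict_mono) auto
    then have "exp (- a * R\<^sup>2) < h x" using a by (simp add: h_def)
    then show ?thesis using d by (simp add: g_def)
  qed
  show thesis
  proof (rule that[of w])
    show "continuous_on UNIV w"
      unfolding w_def g_def h_def by (intro continuous_intros cont)
    show "0 \<le> w x" for x using nonneg[of x] by (simp add: w_def)
    show "laplacian_nonneg_at w x" for x
    proof (cases "g x \<le> v x")
      case True
      then show ?thesis
        by (intro laplacian_nonneg_at_touching[OF lap]) (auto simp: w_def)
    next
      case False
      then have "x \<notin> ball y s" using s(2) g_less[of x] by (auto simp: subset_iff)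
      then show ?thesis
        using False by (intro laplacian_nonneg_at_touching[OF lap_g]) (auto simp: w_def)
    qed
    show "0 < w x" if "x \<in> ball y R" for x
      using g_inside[OF that] by (simp add: w_def)
    show "w x = v x" if "x \<notin> ball y R" for x
      using g_outside[OF that] nonneg[of x] by (simp add: w_def)
  qed
qed

text \<open>
  The set \<open>A\<close> of points at which a suitable function is positive is open. It meets \<open>W\<close> far away
  from \<open>K\<close>, and by the spreading of positivity it contains each of its limit points in \<open>W\<close>; so the
  connected set \<open>W\<close> lies in \<open>A\<close>.
\<close>
lemma subharmonic_separation:
  fixes K W :: "(real ^ 'n) set"
  assumes K: "bounded K" and W: "open W" "connected W" "\<not> bounded W" "W \<inter> K = {}" and y: "y \<in> W"
  obtains v where "continuous_on UNIV v" "\<And>x. 0 \<le> v x" "\<And>x. laplacian_nonneg_at v x"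
    "\<And>x. x \<in> K \<Longrightarrow> v x = 0" "0 < v y"
proof -
  define P where "P v \<longleftrightarrow> continuous_on UNIV v \<and> (\<forall>x. 0 \<le> v x) \<and> (\<forall>x. laplacian_nonneg_at v x)
      \<and> (\<forall>x\<in>K. v x = 0)" for v :: "real ^ 'n \<Rightarrow> real"
  define A where "A = {x. \<exists>v. P v \<and> 0 < v x}"
  have "open A"
  proof -
    have "A = (\<Union>v\<in>{v. P v}. {x. 0 < v x})" by (auto simp: A_def)
    moreover have "open {x. 0 < v x}" if "P v" for v
      using that by (intro open_Collect_less) (auto simp: P_def)
    ultimately show ?thesis by auto
  qed
  obtain M where M: "0 < M" "K \<subseteq> cball 0 M"
    using K bounded_subset_ballD[OF K, of 0] ball_subset_cball by blast
  obtain z where z: "z \<in> W" "M < norm z"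
    using W(3) by (meson bounded_iff not_le)
  define v0 where "v0 = (\<lambda>x :: real ^ 'n. max 0 ((norm x)\<^sup>2 + - (M\<^sup>2)))"
  have "P v0"
    unfolding P_def
  proof (intro conjI allI ballI)
    show "continuous_on UNIV v0" unfolding v0_def by (intro continuous_intros)
    show "0 \<le> v0 x" for x by (simp add: v0_def)
    show "laplacian_nonneg_at v0 x" for x
    proof (cases "v0 x = 0")
      case True
      then show ?thesis
        by (intro laplacian_nonneg_at_touching[OF laplacian_nonneg_at_const[of 0]]) (auto simp: v0_def)
    next
      case False
      have "laplacian_nonneg_at (\<lambda>x. (norm x)\<^sup>2 + - (M\<^sup>2)) x"
        unfolding laplacian_nonneg_at_add_const by (rule laplacian_nonneg_at_norm_square)
      then show ?thesis
        by (rule laplacian_nonneg_at_touching) (use False in \<open>auto simp: v0_def max_def split: if_splits\<close>)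
    qed
    show "v0 x = 0" if "x \<in> K" for x
    proof -
      have "(norm x)\<^sup>2 \<le> M\<^sup>2" using that M(2) by (intro power_mono) auto
      then show ?thesis by (simp add: v0_def)
    qed
  qed
  moreover have "0 < v0 z"
  proof -
    have "M\<^sup>2 < (norm z)\<^sup>2" using z(2) M(1) by (intro power_strict_mono) auto
    then show ?thesis by (simp add: v0_def)
  qed
  ultimately have zA: "z \<in> A" by (auto simp: A_def)
  have closed: "x \<in> A" if x: "x \<in> W" "x \<in> closure A" for x
  proof -
    \<comment> \<open>Twice the radius, so that the ball of radius \<open>e\<close> about a nearby point \<open>y\<close> contains \<open>x\<close> and still misses \<open>K\<close>.\<close>
    obtain e where e: "0 < e" "ball x (2 * e) \<subseteq> W"
      using W(1) x(1) by (metis openE mult.commute field_sum_of_halves half_gt_zero mult_2)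
    obtain y where y: "y \<in> A" "dist y x < e"
      using x(2) e(1) by (meson closure_approachable)
    obtain v where v: "P v" "0 < v y" using y(1) by (auto simp: A_def)
    obtain w where w: "continuous_on UNIV w" "\<And>x. 0 \<le> w x" "\<And>x. laplacian_nonneg_at w x"
        "\<And>x. x \<in> ball y e \<Longrightarrow> 0 < w x" "\<And>x. x \<notin> ball y e \<Longrightarrow> w x = v x"
      using hopf_barrier_spreads_positivity[of v y e] v e(1) unfolding P_def by metis
    have "w p = 0" if "p \<in> K" for p
    proof -
      have "p \<notin> ball x (2 * e)" using that e(2) W(4) by auto
      then have "p \<notin> ball y e"
        using y(2) dist_triangle[of x p y] by (auto simp: dist_commute)
      then show ?thesis using w(5) v(1) that by (simp add: P_def)
    qed
    then have "P w" using w by (simp add: P_def)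
    moreover have "0 < w x" using y(2) by (intro w(4)) simp
    ultimately show ?thesis by (auto simp: A_def)
  qed
  have "W \<subseteq> A"
  proof (rule ccontr)
    assume "\<not> W \<subseteq> A"
    then have "- closure A \<inter> W \<noteq> {}" using closed by auto
    moreover have "A \<inter> W \<noteq> {}" using zA z(1) by auto
    moreover have "W \<subseteq> A \<union> - closure A" using closed by auto
    moreover have "A \<inter> - closure A \<inter> W = {}" using closure_subset[of A] by auto
    ultimately show False
      using connectedD[OF W(2) \<open>open A\<close>, of "- closure A"] by auto
  qed
  then obtain v where "P v" "0 < v y" using y by (auto simp: A_def)
  then show thesis using that[of v] by (simp add: P_def)
qed

section \<open>The complement of the singular set inside its neighbourhoods\<close>

text \<open>
  The set \<open>S \<inter> V\<close> is closed, since it arises from \<open>S\<close> by removing the other open components of \<open>N\<close>.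
  Its complement is the union of \<open>- S\<close> with these components, each of which meets \<open>- S\<close>; hence it is
  connected. Unicoherence of the space, applied to \<open>V\<close> and this complement, gives the claim.
\<close>
lemma connected_component_minus_closed:
  fixes S N V :: "'a::euclidean_space set"
  assumes S: "closed S" "interior S = {}" "connected (- S)" "S \<noteq> UNIV"
    and N: "open N" "S \<subseteq> N" and V: "V \<in> components N"
  shows "connected (V - S)"
proof -
  have oV: "open V" using N(1) V by (rule open_components)
  have meets: "V' \<inter> - S \<noteq> {}" if "V' \<in> components N" for V'
    using that S(2) open_components[OF N(1) that] in_components_nonempty[OF that] interior_maximal[of V' S]
    by auto
  define others where "others = \<Union> (components N - {V})"
  have cover: "N = V \<union> others"
  proof -
    have "N = \<Union> (insert V (components N - {V}))"
      using V by (simp add: insert_absorb flip: Union_components)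
    then show ?thesis unfolding Union_insert others_def .
  qed
  have disjoint: "V \<inter> others = {}"
    using components_nonoverlap[OF V] by (auto simp: others_def)
  have closedSV: "closed (S \<inter> V)"
  proof -
    have "S \<inter> V = S \<inter> - others" using N(2) cover disjoint by blast
    moreover have "open others"
      unfolding others_def using open_components[OF N(1)] by (intro open_Union) auto
    ultimately show ?thesis using S(1) by (metis closed_Compl closed_Int)
  qed
  have "- (S \<inter> V) = - S \<union> others" using N(2) cover disjoint by blast
  also have "\<dots> = \<Union> (insert (- S) ((\<lambda>V'. - S \<union> V') ` (components N - {V})))"
    by (auto simp: others_def)
  finally have "- (S \<inter> V) = \<Union> (insert (- S) ((\<lambda>V'. - S \<union> V') ` (components N - {V})))" .
  moreover have "connected (\<Union> (insert (- S) ((\<lambda>V'. - S \<union> V') ` (components N - {V}))))"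
  proof (rule connected_Union)
    fix X assume "X \<in> insert (- S) ((\<lambda>V'. - S \<union> V') ` (components N - {V}))"
    then show "connected X"
      using S(3) meets in_components_connected by (auto intro!: connected_Un)
  next
    show "\<Inter> (insert (- S) ((\<lambda>V'. - S \<union> V') ` (components N - {V}))) \<noteq> {}"
      using S(4) by auto
  qed
  ultimately have "connected (- (S \<inter> V))" by simp
  then have "connected (V \<inter> - (S \<inter> V))"
    by (intro open_unicoherent_UNIV oV open_Compl closedSV in_components_connected[OF V]) auto
  moreover have "V \<inter> - (S \<inter> V) = V - S" by blast
  ultimately show ?thesis by simp
qed

section \<open>Construction of the family\<close>

text \<open>
  The spike point \<open>y\<close> lies in \<open>V - S\<close>, where \<open>V\<close> is the component of \<open>a\<close> in the \<open>\<epsilon>\<close>-neighbourhood of \<open>S\<close>.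
  This set is open, connected and unbounded, and it avoids \<open>S\<close> as well as all points at distance at
  least \<open>\<epsilon>\<close> from \<open>S\<close>.
\<close>
lemma exists_subharmonic_spike:
  fixes S :: "(real ^ 'n) set"
  assumes S: "closed S" "interior S = {}" "\<forall>C\<in>components S. \<not> bounded C" "connected (- S)"
    and a: "a \<in> S" and \<epsilon>: "0 < \<epsilon>" and M: "0 \<le> M"
  shows "\<exists>v y. continuous_on UNIV v \<and> (\<forall>x. 0 \<le> v x) \<and> (\<forall>x. laplacian_nonneg_at v x)
      \<and> (\<forall>x\<in>S. norm x \<le> r \<longrightarrow> v x = 0)
      \<and> (\<forall>x. (\<forall>s\<in>S. \<epsilon> \<le> dist s x) \<longrightarrow> norm x \<le> r \<longrightarrow> v x = 0)
      \<and> dist a y < \<epsilon> \<and> M < v y"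
proof -
  define N where "N = (\<Union>s\<in>S. ball s \<epsilon>)"
  have N: "open N" "S \<subseteq> N" using \<epsilon> by (auto simp: N_def)
  define V where "V = connected_component_set N a"
  have V: "V \<in> components N" using a N(2) by (auto simp: V_def components_def)
  have oV: "open V" using N(1) V by (rule open_components)
  have ball_V: "ball a \<epsilon> \<subseteq> V"
    unfolding V_def using a \<epsilon> by (intro connected_component_maximal) (auto simp: N_def)
  have "interior S \<noteq> UNIV" using S(2) by simp
  then have "S \<noteq> UNIV" by auto
  then have conn: "connected (V - S)"
    using S N V by (intro connected_component_minus_closed)
  have meets: "\<exists>z. z \<in> U \<and> z \<notin> S" if "open U" "U \<noteq> {}" for U
    using that S(2) interior_maximal[of U S] by auto
  have "connected_component_set S a \<in> components S" using a by (auto simp: components_def)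
  then have "\<not> bounded (connected_component_set S a)" using S(3) by blast
  moreover have "connected_component_set S a \<subseteq> V"
    unfolding V_def by (rule connected_component_mono[OF N(2)])
  ultimately have unb: "\<not> bounded V" using bounded_subset by blast
  have unb_diff: "\<not> bounded (V - S)"
  proof
    assume "bounded (V - S)"
    then obtain b where b: "\<And>x. x \<in> V - S \<Longrightarrow> norm x \<le> b" by (meson bounded_iff)
    obtain z where z: "z \<in> V" "b < norm z" using unb by (meson bounded_iff not_le)
    have "open (V \<inter> {x. b < norm x})"
      using oV by (intro open_Int open_Collect_less continuous_intros)
    then obtain x where "x \<in> V" "b < norm x" "x \<notin> S" using meets z by blast
    then show False using b[of x] by simp
  qed
  have "open (V - S)" using oV S(1) by (rule open_Diff)
  obtain y where y: "y \<in> ball a \<epsilon>" "y \<notin> S" using meets[of "ball a \<epsilon>"] \<epsilon> by auto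
  define K where "K = cball 0 r - (V - S)"
  have "bounded K" unfolding K_def by (intro bounded_diff) simp
  moreover have "(V - S) \<inter> K = {}" by (auto simp: K_def)
  moreover have "y \<in> V - S" using y ball_V by blast
  ultimately obtain w where w: "continuous_on UNIV w" "\<And>x. 0 \<le> w x" "\<And>x. laplacian_nonneg_at w x"
      "\<And>x. x \<in> K \<Longrightarrow> w x = 0" "0 < w y"
    using subharmonic_separation[of K "V - S" y] \<open>open (V - S)\<close> conn unb_diff by metis
  define c where "c = (M + 1) / w y"
  have c: "0 \<le> c" using w(5) M by (simp add: c_def)
  have V_N: "V \<subseteq> N" unfolding V_def by (rule connected_component_subset)
  have "M < c * w y" using w(5) by (simp add: c_def)
  moreover have "continuous_on UNIV (\<lambda>x. c * w x)" by (intro continuous_intros w)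
  moreover have "laplacian_nonneg_at (\<lambda>x. c * w x) x" for x
    by (intro laplacian_nonneg_at_scale w c)
  moreover have "c * w x = 0" if "x \<in> S" "norm x \<le> r" for x
    using w(4)[of x] that by (simp add: K_def)
  moreover have "c * w x = 0" if "\<forall>s\<in>S. \<epsilon> \<le> dist s x" "norm x \<le> r" for x
  proof -
    have "x \<notin> N" using that(1) by (force simp: N_def)
    then show ?thesis using w(4)[of x] that(2) V_N by (auto simp: K_def)
  qed
  ultimately show ?thesis
    using y(1) c w(2) by (intro exI[of _ "\<lambda>x. c * w x"] exI[of _ y]) simp
qed

theorem theorem3p5:
  fixes S :: "(real ^ 'n) set"
  assumes "CARD('n) \<ge> 2"
    and "closed S"
    and "interior (closure S) = {}"
    and "\<forall>C\<in>components S. \<not> bounded C"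
    and "connected (UNIV - S)"
  shows "\<exists>(I :: (real ^ 'n \<Rightarrow> ereal) set) (u :: (real ^ 'n \<Rightarrow> ereal) \<Rightarrow> real ^ 'n \<Rightarrow> ereal).
           (\<forall>\<nu>\<in>I. subharmonic_on UNIV (u \<nu>)) \<and>
           (\<forall>x. \<bar>SUP \<nu>\<in>I. u \<nu> x\<bar> \<noteq> \<infinity>) \<and>
           (\<forall>x\<in>S. locally_unbounded_at (\<lambda>x. SUP \<nu>\<in>I. u \<nu> x) x)"
proof (cases "S = {}")
  case True
  have "subharmonic_on UNIV (\<lambda>x :: real ^ 'n. ereal 0)"
    by (intro subharmonic_on_UNIV_of_laplacian_nonneg laplacian_nonneg_at_const) auto
  then show ?thesis
    using True by (intro exI[of _ "{\<lambda>_. ereal 0}"] exI[of _ "\<lambda>\<nu>. \<nu>"]) auto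
next
  case False
  have S: "closed S" "interior S = {}" "\<forall>C\<in>components S. \<not> bounded C" "connected (- S)"
    using assms by (auto simp: Compl_eq_Diff_UNIV)
  obtain D where D: "countable D" "D \<subseteq> S" "S \<subseteq> closure D"
    by (rule separable)
  have "D \<noteq> {}" using D(3) False by auto
  \<comment> \<open>The second component of the pairing is ignored, so that every point of \<open>D\<close> occurs for infinitely many \<open>n\<close>.\<close>
  define a where "a n = from_nat_into D (fst (prod_decode n))" for n
  have aS: "a n \<in> S" for n
    using D(2) from_nat_into[OF \<open>D \<noteq> {}\<close>] by (auto simp: a_def)
  have "\<exists>v y. continuous_on UNIV v \<and> (\<forall>x. 0 \<le> v x) \<and> (\<forall>x. laplacian_nonneg_at v x)
      \<and> (\<forall>x\<in>S. norm x \<le> real n \<longrightarrow> v x = 0)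
      \<and> (\<forall>x. (\<forall>s\<in>S. inverse (real (Suc n)) \<le> dist s x) \<longrightarrow> norm x \<le> real n \<longrightarrow> v x = 0)
      \<and> dist (a n) y < inverse (real (Suc n)) \<and> real n < v y" for n
    by (rule exists_subharmonic_spike[OF S aS]) auto
  then obtain v y where cont: "\<And>n. continuous_on UNIV (v n)" and nonneg: "\<And>n x. 0 \<le> v n x"
    and lap: "\<And>n x. laplacian_nonneg_at (v n) x"
    and zero_S: "\<And>n x. x \<in> S \<Longrightarrow> norm x \<le> real n \<Longrightarrow> v n x = 0"
    and zero_far: "\<And>n x. \<forall>s\<in>S. inverse (real (Suc n)) \<le> dist s x \<Longrightarrow> norm x \<le> real n \<Longrightarrow> v n x = 0"
    and y_near: "\<And>n. dist (a n) (y n) < inverse (real (Suc n))" and y_large: "\<And>n. real n < v n (y n)"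
    by metis
  have eventually_0: "\<exists>n0. \<forall>n\<ge>n0. v n x = 0" for x
  proof (cases "x \<in> S")
    case True
    obtain n0 where "norm x \<le> real n0" using real_arch_simple by blast
    then show ?thesis using True by (intro exI[of _ n0]) (auto intro!: zero_S)
  next
    case False
    then obtain e where e: "0 < e" "ball x e \<subseteq> - S" using S(1) by (metis ComplI open_Compl openE)
    obtain n1 where n1: "norm x \<le> real n1" using real_arch_simple by blast
    obtain n2 where n2: "inverse (real (Suc n2)) < e" using reals_Archimedean[OF e(1)] by blast
    have "v n x = 0" if n: "max n1 n2 \<le> n" for n
    proof (rule zero_far)
      show "norm x \<le> real n" using n1 n by linarith
      show "\<forall>s\<in>S. inverse (real (Suc n)) \<le> dist s x"
      proof
        fix s assume "s \<in> S"
        then have "e \<le> dist s x" using e(2) by (force simp: dist_commute)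
        moreover have "inverse (real (Suc n)) \<le> inverse (real (Suc n2))"
          using n by (intro le_imp_inverse_le) auto
        ultimately show "inverse (real (Suc n)) \<le> dist s x" using n2 by linarith
      qed
    qed
    then show ?thesis by blast
  qed
  define I where "I = range (\<lambda>n x. ereal (v n x))"
  have SUP_I: "(SUP \<nu>\<in>I. \<nu> x) = (SUP n. ereal (v n x))" for x
    by (simp add: I_def image_image)
  have upper: "ereal (v n x) \<le> (SUP \<nu>\<in>I. \<nu> x)" for n x
    unfolding SUP_I by (rule SUP_upper) simp
  show ?thesis
  proof (intro exI[of _ I] exI[of _ "\<lambda>\<nu>. \<nu>"] conjI ballI allI)
    show "subharmonic_on UNIV \<nu>" if "\<nu> \<in> I" for \<nu>
      using that cont nonneg lap by (auto simp: I_def intro!: subharmonic_on_UNIV_of_laplacian_nonneg)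
    fix x
    obtain n0 where n0: "\<And>n. n \<ge> n0 \<Longrightarrow> v n x = 0" using eventually_0 by metis
    have "v n x \<le> (\<Sum>k<n0. v k x)" for n
      using n0[of n] nonneg by (cases "n < n0") (auto intro!: member_le_sum sum_nonneg)
    then have "(SUP \<nu>\<in>I. \<nu> x) \<le> ereal (\<Sum>k<n0. v k x)"
      unfolding SUP_I by (intro SUP_least) (simp del: sum_ereal)
    moreover have "ereal 0 \<le> (SUP \<nu>\<in>I. \<nu> x)"
      using upper[of 0 x] nonneg[of 0 x] by (metis ereal_less_eq(3) order_trans)
    ultimately show "\<bar>SUP \<nu>\<in>I. \<nu> x\<bar> \<noteq> \<infinity>"
      by (cases "SUP \<nu>\<in>I. \<nu> x") auto
  next
    fix x assume x: "x \<in> S"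
    show "locally_unbounded_at (\<lambda>x. SUP \<nu>\<in>I. \<nu> x) x"
      unfolding locally_unbounded_at_def
    proof (intro allI impI notI, elim conjE exE)
      fix U M
      assume U: "open U" "x \<in> U" and M: "\<forall>y\<in>U. (SUP \<nu>\<in>I. \<nu> y) \<le> ereal M"
      obtain e where e: "0 < e" "ball x e \<subseteq> U" using U by (meson openE)
      obtain d where d: "d \<in> D" "dist d x < e / 2"
        using D(3) x e(1) by (meson closure_approachable half_gt_zero subsetD)
      obtain i where i: "from_nat_into D i = d" using from_nat_into_surj[OF D(1) d(1)] by blast
      obtain j1 where j1: "M \<le> real j1" using real_arch_simple by blast
      obtain j2 where j2: "inverse (real (Suc j2)) < e / 2"
        using reals_Archimedean[of "e / 2"] e(1) by auto
      define n where "n = prod_encode (i, max j1 j2)"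
      have n: "max j1 j2 \<le> n" unfolding n_def by (rule le_prod_encode_2)
      have "a n = d" by (simp add: a_def n_def i)
      then have "dist d (y n) < inverse (real (Suc n))" using y_near[of n] by simp
      moreover have "inverse (real (Suc n)) \<le> inverse (real (Suc j2))"
        using n by (intro le_imp_inverse_le) auto
      ultimately have "dist d (y n) < e / 2" using j2 by linarith
      then have "dist x (y n) < e" using d(2) dist_triangle3[of x "y n" d] by linarith
      then have "y n \<in> U" using e(2) by auto
      then have "ereal (v n (y n)) \<le> ereal M" using M upper order_trans by blast
      then show False using y_large[of n] j1 n by simp
    qed
  qed
qed

end
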